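(* Let $(\mathcal{L}_n(x))_{n\ge 0}$ be a Lucas-type polynomial sequence determined by $p_0$, $p_1(x)$, $d(x)=\alpha p_1(x)$ and $g(x)$. Let $q>2$ be a prime number and let $d(x)=a_kx^k+a_{k-1}x^{k-1}+\dots+a_1x+a_0$, where $a_k\not\equiv 0 \pmod q$ and $a_i\equiv 0\pmod q$ for $i=0,1,\dots,k-1$. If $g(0)\not\equiv 0\pmod q$, then $\mathcal{L}_q(x)/p_1(x)$ is irreducible over $\mathbb{Q}$.
   Context: A Lucas-type polynomial sequence is determined by an integer $p_0$ with $|p_0|\in\{1,2\}$ and non-zero polynomials $p_1(x),g(x)\in\mathbb{Z}[x]$; put $\alpha=2/p_0\in\mathbb{Z}$ and $d(x)=\alpha p_1(x)$. Then $\mathcal{L}_0(x)=p_0$, $\mathcal{L}_1(x)=p_1(x)$, and $\mathcal{L}_n(x)=d(x)\mathcal{L}_{n-1}(x)+g(x)\mathcal{L}_{n-2}(x)$ for $n\ge 2$. Standing assumptions: $\gcd(d(x),g(x))=1$, $\deg(g)<\deg(d)$, $\gcd(p_0,p_1(x))=\gcd(p_0,d(x))=\gcd(p_0,g(x))=1$, and $\deg(p_1)\ge 1$ (so $k\ge1$), where $\gcd=1$ means that the only common divisors in $\mathbb{Z}[x]$ are $\pm 1$. *)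

theory Defs
  imports "HOL-Computational_Algebra.Computational_Algebra" "HOL-Number_Theory.Cong"
begin

text \<open>The division is exact for the admissible values \<open>\<bar>p0\<bar> \<in> {1, 2}\<close>.\<close>
definition lucas_alpha :: "int \<Rightarrow> int" where
  "lucas_alpha p0 = 2 div p0"

definition lucas_d :: "int \<Rightarrow> int poly \<Rightarrow> int poly" where
  "lucas_d p0 p1 = smult (lucas_alpha p0) p1"

fun lucas_poly :: "int \<Rightarrow> int poly \<Rightarrow> int poly \<Rightarrow> nat \<Rightarrow> int poly" where
  "lucas_poly p0 p1 g 0 = [:p0:]"
| "lucas_poly p0 p1 g (Suc 0) = p1"
| "lucas_poly p0 p1 g (Suc (Suc n)) =
     lucas_d p0 p1 * lucas_poly p0 p1 g (Suc n) + g * lucas_poly p0 p1 g n"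

text \<open>Coprimality is taken in \<open>\<int>[x]\<close>, whose only units are \<open>1\<close> and \<open>-1\<close>; in particular the
  integer \<open>p0\<close> is regarded as a constant polynomial.\<close>
definition lucas_type :: "int \<Rightarrow> int poly \<Rightarrow> int poly \<Rightarrow> bool" where
  "lucas_type p0 p1 g \<longleftrightarrow>
     \<bar>p0\<bar> \<in> {1, 2} \<and> p1 \<noteq> 0 \<and> g \<noteq> 0 \<and>
     coprime (lucas_d p0 p1) g \<and>
     degree g < degree (lucas_d p0 p1) \<and>
     coprime [:p0:] p1 \<and> coprime [:p0:] (lucas_d p0 p1) \<and> coprime [:p0:] g \<and>
     degree p1 \<ge> 1"

end

theory Submission
  imports Defs
begin

text \<open>
  Write \<open>q = 2 m + 1\<close>. The quotient \<open>L_q / p1\<close> is the Dickson-type sum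
  \<open>\<Sum>i\<le>m. e i d^(2 i) g^(m - i)\<close> with
  \<open>e i = q / (m + i + 1) * (m + i + 1 choose m - i)\<close>. As \<open>q\<close> is prime, it divides every
  \<open>e i\<close> except \<open>e m = 1\<close>, and \<open>e 0 = q\<close>. The quotient is thus congruent to
  \<open>d^(q - 1)\<close>, hence to a monomial, modulo \<open>q\<close>, while its constant term is congruent to
  \<open>q g(0)^m\<close> modulo \<open>q^2\<close>: it is an Eisenstein polynomial at \<open>q\<close>.
\<close>

section \<open>Eisenstein's criterion\<close>

lemma clear_denominators:
  fixes r :: "rat poly"
  obtains c :: int and R :: "int poly"
  where "c \<noteq> 0" "smult (of_int c) r = map_poly rat_of_int R"
proof -
  have "\<exists>c R. c \<noteq> 0 \<and> smult (of_int c) r = map_poly rat_of_int R"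
  proof (induction r)
    case 0
    show ?case by (rule exI[of _ 1], rule exI[of _ 0]) simp
  next
    case (pCons a r)
    then obtain c R where c: "c \<noteq> 0" "smult (of_int c) r = map_poly rat_of_int R"
      by blast
    obtain n k where nk: "a = of_int n / of_int k" "k > 0"
      using quotient_of_div quotient_of_denom_pos by (metis surj_pair)
    have "smult (of_int (c * k)) (pCons a r) =
        pCons (of_int (c * n)) (smult (of_int k) (smult (of_int c) r))"
      using nk by (simp add: mult.commute)
    also have "\<dots> = map_poly rat_of_int (pCons (c * n) (smult k R))"
      unfolding c(2) by (simp add: map_poly_pCons map_poly_smult)
    finally show ?case using c(1) nk(2)
      by (intro exI[of _ "c * k"] exI[of _ "pCons (c * n) (smult k R)"]) auto
  qed
  then show thesis using that by blast
qed

lemma map_poly_of_int_smult: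
  "map_poly rat_of_int (smult c G) = smult (of_int c) (map_poly rat_of_int G)"
  by (intro poly_eqI) (simp add: coeff_map_poly)

lemma map_poly_of_int_mult:
  "map_poly rat_of_int (G * H) = map_poly rat_of_int G * map_poly rat_of_int H"
  by (intro poly_eqI) (simp add: coeff_map_poly coeff_mult)

lemma map_poly_of_int_eq_iff:
  "map_poly rat_of_int G = map_poly rat_of_int H \<longleftrightarrow> G = H"
  by (auto simp: poly_eq_iff coeff_map_poly)

lemma degree_map_poly_of_int [simp]: "degree (map_poly rat_of_int G) = degree G"
  by (rule degree_map_poly) simp

text \<open>This is Gauss's lemma. Clearing denominators gives a factorization over the integers of
  a nonzero multiple of \<open>f\<close>; primitive parts are multiplicative, so passing to them
  removes that multiple up to sign. The content of \<open>f\<close> is then given back to the first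
  factor. Only nonzero scalars are involved, so degrees survive.\<close>

lemma int_factors_of_rat_factors:
  fixes f :: "int poly" and r s :: "rat poly"
  assumes rs: "map_poly rat_of_int f = r * s" and "f \<noteq> 0"
  obtains G H where "f = G * H" "degree G = degree r" "degree H = degree s"
proof -
  obtain a R where a: "a \<noteq> 0" "smult (of_int a) r = map_poly rat_of_int R"
    by (rule clear_denominators)
  obtain b S where b: "b \<noteq> 0" "smult (of_int b) s = map_poly rat_of_int S"
    by (rule clear_denominators)
  have "map_poly rat_of_int (smult (a * b) f) = smult (of_int a * of_int b) (r * s)"
    by (simp only: map_poly_of_int_smult of_int_mult rs)
  also have "\<dots> = smult (of_int a) r * smult (of_int b) s"
    by (simp add: mult.commute[of "of_int a"])
  also have "\<dots> = map_poly rat_of_int (R * S)"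
    by (simp add: a b map_poly_of_int_mult)
  finally have RS: "smult (a * b) f = R * S"
    by (simp only: map_poly_of_int_eq_iff)
  then have "smult (unit_factor (a * b)) (primitive_part f) = primitive_part R * primitive_part S"
    by (metis primitive_part_mult primitive_part_smult)
  \<comment> \<open>Multiplying by the sign once more moves it to the right-hand side, since its
    square is 1.\<close>
  then have "smult (sgn (a * b) * sgn (a * b)) (primitive_part f)
      = smult (sgn (a * b)) (primitive_part R * primitive_part S)"
    by (metis smult_smult unit_factor_int_def)
  then have "primitive_part f = smult (sgn (a * b)) (primitive_part R * primitive_part S)"
    using a b by (simp add: sgn_mult) (simp add: sgn_if split: if_splits)
  then have f: "f = smult (content f * sgn (a * b)) (primitive_part R) * primitive_part S"
    by (metis content_times_primitive_part mult_smult_left smult_smult)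
  have "degree R = degree r" "degree S = degree s"
    using a b by (metis degree_map_poly_of_int degree_smult_eq of_int_eq_0_iff)+
  then show thesis
    using a b \<open>f \<noteq> 0\<close> by (intro that[OF f]) (auto simp: sgn_0_0)
qed

text \<open>Let \<open>i\<close> be the least index with \<open>coeff G i\<close> not divisible by
  \<open>p\<close>. Modulo \<open>p\<close>, coefficient \<open>i\<close> of \<open>G * H\<close>
  reduces to \<open>coeff G i * coeff H 0\<close>, which is nonzero. If \<open>H\<close> were
  nonconstant, \<open>i \<le> degree G\<close> would lie below \<open>degree (G * H)\<close>, where
  all coefficients vanish modulo \<open>p\<close>.\<close>

lemma eisenstein_factor:
  fixes G H :: "'a :: idom poly"
  assumes "prime_elem p" "p dvd coeff G 0" "\<not> p dvd coeff H 0"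
    and lead: "\<not> p dvd lead_coeff (G * H)"
    and lower: "\<And>i. i < degree (G * H) \<Longrightarrow> p dvd coeff (G * H) i"
  shows "degree H = 0"
proof (rule ccontr)
  assume "degree H \<noteq> 0"
  have "\<not> p dvd lead_coeff G"
    using lead by (auto simp: lead_coeff_mult)
  define i where "i = (LEAST i. \<not> p dvd coeff G i)"
  have i: "\<not> p dvd coeff G i" "i \<le> degree G"
    unfolding i_def using \<open>\<not> p dvd lead_coeff G\<close> by (rule LeastI, rule Least_le)
  have least: "p dvd coeff G j" if "j < i" for j
    using that not_less_Least unfolding i_def by blast
  have "G \<noteq> 0" "H \<noteq> 0" using assms by auto
  then have "i < degree (G * H)"
    using i \<open>degree H \<noteq> 0\<close> by (simp add: degree_mult_eq)
  then have "p dvd coeff (G * H) i" by (rule lower)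
  moreover have "coeff (G * H) i = (\<Sum>j<i. coeff G j * coeff H (i - j)) + coeff G i * coeff H 0"
    by (simp add: coeff_mult lessThan_Suc_atMost[symmetric])
  moreover have "p dvd (\<Sum>j<i. coeff G j * coeff H (i - j))"
    by (intro dvd_sum dvd_mult2 least) auto
  ultimately have "p dvd coeff G i * coeff H 0"
    by (simp add: dvd_add_right_iff)
  with assms i show False
    by (auto simp: prime_elem_dvd_mult_iff)
qed

text \<open>If \<open>f\<close> is a monomial modulo \<open>p\<close>, so are its powers. In each
  convolution term below the top degree, at least one of the two indices is below the degree of its
  factor.\<close>

lemma dvd_lower_coeff_power:
  fixes f :: "'a :: idom poly"
  assumes "f \<noteq> 0" and lower: "\<And>i. i < degree f \<Longrightarrow> p dvd coeff f i"
  shows "i < degree (f ^ n) \<Longrightarrow> p dvd coeff (f ^ n) i"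
proof (induction n arbitrary: i)
  case (Suc n)
  have "p dvd coeff f j * coeff (f ^ n) (i - j)" if "j \<le> i" for j
  proof (cases "j < degree f")
    case True
    then show ?thesis by (simp add: lower)
  next
    case False
    then have "i - j < degree (f ^ n)"
      using Suc.prems that \<open>f \<noteq> 0\<close> by (simp add: degree_mult_eq)
    then show ?thesis by (simp add: Suc.IH)
  qed
  then show ?case
    by (auto simp: coeff_mult intro: dvd_sum)
qed simp

theorem eisenstein:
  fixes f :: "int poly" and p :: int
  assumes "prime p" "degree f > 0" and lead: "\<not> p dvd lead_coeff f"
    and lower: "\<And>i. i < degree f \<Longrightarrow> p dvd coeff f i"
    and const: "\<not> p\<^sup>2 dvd coeff f 0"
  shows "irreducible (map_poly rat_of_int f)"
proof (rule irreducibleI)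
  have "f \<noteq> 0" using assms by auto
  then show "map_poly rat_of_int f \<noteq> 0"
    using map_poly_of_int_eq_iff[of f 0] by simp
  show "\<not> map_poly rat_of_int f dvd 1"
    using \<open>degree f > 0\<close> \<open>map_poly rat_of_int f \<noteq> 0\<close> by (simp add: is_unit_iff_degree)
  fix r s assume rs: "map_poly rat_of_int f = r * s"
  then obtain G H where GH: "f = G * H" "degree G = degree r" "degree H = degree s"
    using \<open>f \<noteq> 0\<close> by (rule int_factors_of_rat_factors)
  have p: "prime_elem p" using assms(1) by (rule prime_imp_prime_elem)
  have "p dvd coeff f 0" using lower assms by blast
  then have "p dvd coeff G 0 \<or> p dvd coeff H 0"
    using p by (simp add: GH coeff_mult prime_elem_dvd_mult_iff)
  \<comment> \<open>So \<open>p\<close> divides exactly one of the two constant terms, and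
    \<open>eisenstein_factor\<close> applies in one of the two orders.\<close>
  moreover have "\<not> (p dvd coeff G 0 \<and> p dvd coeff H 0)"
    using const by (auto simp: GH coeff_mult power2_eq_square mult_dvd_mono)
  ultimately have "degree G = 0 \<or> degree H = 0"
    using eisenstein_factor[of p G H] eisenstein_factor[of p H G] p lead lower
    unfolding GH(1) by (auto simp: mult.commute[of H G])
  moreover have "r \<noteq> 0" "s \<noteq> 0"
    using rs \<open>map_poly rat_of_int f \<noteq> 0\<close> by auto
  ultimately show "r dvd 1 \<or> s dvd 1"
    using GH by (auto simp: is_unit_iff_degree)
qed

section \<open>The quotient as a Dickson-type polynomial\<close>

text \<open>\<open>lucas_coeff i j\<close> is the coefficient of \<open>d^i g^j\<close> in \<open>\<alpha> * L_(i + 2 j)\<close>.\<close>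
fun lucas_coeff :: "nat \<Rightarrow> nat \<Rightarrow> nat" where
  "lucas_coeff 0 j = 2"
| "lucas_coeff (Suc i) 0 = 1"
| "lucas_coeff (Suc i) (Suc j) = lucas_coeff i (Suc j) + lucas_coeff (Suc i) j"

text \<open>Stated without division, which also covers \<open>i = j = 0\<close>. The induction
  combines Pascal's rule with the ratio of two neighbouring binomial coefficients.\<close>

lemma lucas_coeff_closed_form:
  "(i + j) * lucas_coeff i j = (i + 2 * j) * ((i + j) choose j)"
proof (induction i j rule: lucas_coeff.induct)
  case (3 i j)
  let ?e = "int (lucas_coeff (Suc i) (Suc j))"
  define N where "N = i + j + 1"
  define A B where "A = int (N choose Suc j)" and "B = int (N choose j)"
  have "Suc j * (N choose Suc j) = (N - j) * (N choose j)"
    by (simp only: binomial_absorb_comp binomial_absorption)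
  moreover have "N - j = Suc i"
    by (simp add: N_def)
  ultimately have "int (Suc j) * A = int (Suc i) * B"
    unfolding A_def B_def by (metis of_nat_mult)
  then have AB: "(int j + 1) * A = (int i + 1) * B"
    by (simp only: of_nat_Suc add.commute)
  have "int ((i + Suc j) * lucas_coeff i (Suc j)) + int ((Suc i + j) * lucas_coeff (Suc i) j)
      = int ((i + 2 * Suc j) * (N choose Suc j)) + int ((Suc i + 2 * j) * (N choose j))"
    unfolding 3 by (simp add: N_def)
  then have e: "int N * ?e = (int i + 2 * int j + 2) * A + (int i + 2 * int j + 1) * B"
    unfolding A_def B_def by (simp add: N_def algebra_simps)
  have N: "int N = int i + int j + 1"
    by (simp add: N_def)
  \<comment> \<open>The induction hypotheses carry the factor \<open>N\<close>, the goal
    \<open>N + 1\<close>. Keeping both factors, the two sides differ by a multiple of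
    \<open>(i + 1) B - (j + 1) A\<close>, which is 0 by \<open>AB\<close>; then \<open>N > 0\<close>
    is cancelled.\<close>
  have "int N * ((int N + 1) * ?e) = (int N + 1) * (int N * ?e)"
    by simp
  also have "\<dots> = int N * ((int i + 2 * int j + 3) * (A + B))
      + ((int i + 1) * B - (int j + 1) * A) * (-1)"
    unfolding e unfolding N by (simp add: algebra_simps)
  finally have "int N * ((int N + 1) * ?e) = int N * ((int i + 2 * int j + 3) * (A + B))"
    using AB by simp
  then have "(int N + 1) * ?e = (int i + 2 * int j + 3) * (A + B)"
    by (simp add: N_def)
  moreover have "A + B = int ((Suc i + Suc j) choose Suc j)"
    by (simp add: A_def B_def N_def)
  ultimately have "int ((Suc i + Suc j) * lucas_coeff (Suc i) (Suc j))
      = int ((Suc i + 2 * Suc j) * ((Suc i + Suc j) choose Suc j))"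
    by (simp only: of_nat_mult) (simp add: N_def algebra_simps)
  then show ?case
    by (simp only: of_nat_eq_iff)
qed auto

text \<open>The closed form makes \<open>q\<close> divide \<open>(i + j) * lucas_coeff i j\<close>,
  and \<open>0 < i + j < q\<close> excludes the first factor.\<close>

lemma prime_dvd_lucas_coeff:
  assumes "prime q" "q = i + 2 * j" "i > 0" "j > 0"
  shows "q dvd lucas_coeff i j"
proof -
  have "q dvd (i + j) * lucas_coeff i j"
    unfolding lucas_coeff_closed_form using assms by simp
  moreover have "\<not> q dvd i + j"
    using assms by (auto dest: dvd_imp_le)
  ultimately show ?thesis
    using \<open>prime q\<close> by (simp add: prime_dvd_mult_iff)
qed

lemma lucas_coeff_1: "lucas_coeff (Suc 0) j = 2 * j + 1"
  by (induction j) auto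

text \<open>The two sums are \<open>\<alpha> * L_(2 m)\<close> and \<open>L_(2 m + 1) / p1\<close>.\<close>
definition lucas_even :: "int poly \<Rightarrow> int poly \<Rightarrow> nat \<Rightarrow> int poly" where
  "lucas_even d g m = (\<Sum>i\<le>m. of_nat (lucas_coeff (2 * i) (m - i)) * d ^ (2 * i) * g ^ (m - i))"

definition lucas_quot :: "int poly \<Rightarrow> int poly \<Rightarrow> nat \<Rightarrow> int poly" where
  "lucas_quot d g m =
    (\<Sum>i\<le>m. of_nat (lucas_coeff (2 * i + 1) (m - i)) * d ^ (2 * i) * g ^ (m - i))"

lemma lucas_even_Suc: "lucas_even d g (Suc m) = d\<^sup>2 * lucas_quot d g m + g * lucas_even d g m"
proof -
  let ?e = "\<lambda>i j. of_nat (lucas_coeff i j) :: int poly"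
  have "lucas_even d g (Suc m) = ?e 0 (Suc m) * g ^ Suc m
      + (\<Sum>i\<le>m. ?e (2 * i + 2) (m - i) * d ^ (2 * i + 2) * g ^ (m - i))"
    unfolding lucas_even_def by (subst sum.atMost_Suc_shift) simp
  also have "(\<Sum>i\<le>m. ?e (2 * i + 2) (m - i) * d ^ (2 * i + 2) * g ^ (m - i)) =
      (\<Sum>i\<le>m. ?e (2 * i + 1) (m - i) * d ^ (2 * i + 2) * g ^ (m - i)) +
      (\<Sum>i<m. ?e (2 * i + 2) (m - Suc i) * d ^ (2 * i + 2) * g ^ (m - i))"
  proof -
    \<comment> \<open>The top index \<open>i = m\<close> is excluded: there the second argument is
      0, both coefficients are 1, and the term goes entirely to the first sum.\<close>
    have "?e (2 * i + 2) (m - i) = ?e (2 * i + 1) (m - i) + ?e (2 * i + 2) (m - Suc i)"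
      if "i < m" for i
      using that by (cases "m - i") (auto simp: Suc_diff_Suc[symmetric])
    then show ?thesis
      by (simp add: lessThan_Suc_atMost[symmetric] sum.distrib[symmetric] algebra_simps)
  qed
  also have "(\<Sum>i\<le>m. ?e (2 * i + 1) (m - i) * d ^ (2 * i + 2) * g ^ (m - i)) =
      d\<^sup>2 * lucas_quot d g m"
    unfolding lucas_quot_def sum_distrib_left
    by (intro sum.cong) (auto simp: algebra_simps power_add power2_eq_square)
  also have "?e 0 (Suc m) * g ^ Suc m + (d\<^sup>2 * lucas_quot d g m
      + (\<Sum>i<m. ?e (2 * i + 2) (m - Suc i) * d ^ (2 * i + 2) * g ^ (m - i)))
      = d\<^sup>2 * lucas_quot d g m + g * lucas_even d g m"
  proof -
    have "lucas_even d g m = ?e 0 m * g ^ m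
        + (\<Sum>i<m. ?e (2 * i + 2) (m - Suc i) * d ^ (2 * i + 2) * g ^ (m - Suc i))"
      unfolding lucas_even_def
      by (cases m) (simp_all add: sum.atMost_Suc_shift lessThan_Suc_atMost del: sum.atMost_Suc)
    moreover have "g * (?e (2 * i + 2) (m - Suc i) * d ^ (2 * i + 2) * g ^ (m - Suc i)) =
        ?e (2 * i + 2) (m - Suc i) * d ^ (2 * i + 2) * g ^ (m - i)" if "i < m" for i
    proof -
      have "m - i = Suc (m - Suc i)" using that by simp
      then show ?thesis by simp
    qed
    then have "g * (\<Sum>i<m. ?e (2 * i + 2) (m - Suc i) * d ^ (2 * i + 2) * g ^ (m - Suc i)) =
        (\<Sum>i<m. ?e (2 * i + 2) (m - Suc i) * d ^ (2 * i + 2) * g ^ (m - i))"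
      unfolding sum_distrib_left by (intro sum.cong) auto
    ultimately show ?thesis
      by (simp only: distrib_left) (simp add: algebra_simps)
  qed
  finally show ?thesis .
qed

lemma lucas_quot_Suc: "lucas_quot d g (Suc m) = lucas_even d g (Suc m) + g * lucas_quot d g m"
proof -
  let ?e = "\<lambda>i j. of_nat (lucas_coeff i j) :: int poly"
  have "?e (2 * i + 1) (Suc m - i) * d ^ (2 * i) * g ^ (Suc m - i) =
      ?e (2 * i) (Suc m - i) * d ^ (2 * i) * g ^ (Suc m - i) +
      g * (?e (2 * i + 1) (m - i) * d ^ (2 * i) * g ^ (m - i))" if "i \<le> m" for i
    using that by (simp add: Suc_diff_le algebra_simps)
  then have "(\<Sum>i\<le>m. ?e (2 * i + 1) (Suc m - i) * d ^ (2 * i) * g ^ (Suc m - i)) =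
      (\<Sum>i\<le>m. ?e (2 * i) (Suc m - i) * d ^ (2 * i) * g ^ (Suc m - i)) +
      g * lucas_quot d g m"
    unfolding lucas_quot_def sum_distrib_left sum.distrib[symmetric] by (intro sum.cong) auto
  then show ?thesis
    unfolding lucas_quot_def[of d g "Suc m"] lucas_even_def sum.atMost_Suc by simp
qed

text \<open>Both parities must be proved together, since each recurrence step uses the other. The
  factor \<open>\<alpha>\<close> on even indices makes them polynomials in \<open>d\<close> and
  \<open>g\<close> alone: the \<open>p1\<close> coming from an odd index is absorbed by
  \<open>\<alpha> * p1 = d\<close>.\<close>

lemma lucas_poly_even_odd:
  assumes "lucas_alpha p0 * p0 = 2" and d: "d = lucas_d p0 p1"
  shows "smult (lucas_alpha p0) (lucas_poly p0 p1 g (2 * m)) = lucas_even d g m \<and>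
         lucas_poly p0 p1 g (2 * m + 1) = p1 * lucas_quot d g m"
proof (induction m)
  case 0
  show ?case using assms by (simp add: lucas_even_def lucas_quot_def numeral_poly)
next
  case (Suc m)
  let ?a = "lucas_alpha p0" and ?L = "lucas_poly p0 p1 g"
  have d': "smult ?a p1 = d" by (simp add: d lucas_d_def)
  have E: "?L (2 * Suc m) = d * ?L (2 * m + 1) + g * ?L (2 * m)"
    by (simp add: d)
  have O: "?L (2 * Suc m + 1) = d * ?L (2 * Suc m) + g * ?L (2 * m + 1)"
    by (simp add: d)
  have even: "smult ?a (?L (2 * Suc m)) = lucas_even d g (Suc m)"
  proof -
    have "smult ?a (?L (2 * Suc m)) =
        d * (smult ?a p1 * lucas_quot d g m) + g * smult ?a (?L (2 * m))"
      unfolding E Suc.IH[THEN conjunct2] by (simp add: smult_add_right del: lucas_poly.simps)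
    then show ?thesis
      using Suc.IH by (simp only: d' lucas_even_Suc power2_eq_square mult.assoc)
  qed
  have "d * ?L (2 * Suc m) = p1 * smult ?a (?L (2 * Suc m))"
    by (simp add: d lucas_d_def)
  then have "?L (2 * Suc m + 1) = p1 * lucas_quot d g (Suc m)"
    unfolding O lucas_quot_Suc even using Suc.IH
    by (simp add: algebra_simps del: lucas_poly.simps)
  with even show ?case ..
qed

lemma lucas_quot_mod_prime:
  assumes q: "prime q" "q = 2 * m + 1" and "m > 0" and deg: "degree g < degree d"
  obtains R where "lucas_quot d g m = d ^ (2 * m) + of_nat q * R"
    "degree R < degree (d ^ (2 * m))" "d dvd R - g ^ m"
proof
  define r where "r = (\<lambda>i. lucas_coeff (2 * i + 1) (m - i) div q)"
  define R where "R = (\<Sum>i<m. of_nat (r i) * d ^ (2 * i) * g ^ (m - i))"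
  have "q * r i = lucas_coeff (2 * i + 1) (m - i)" if "i < m" for i
    unfolding r_def by (rule dvd_mult_div_cancel, rule prime_dvd_lucas_coeff) (use that q in auto)
  then have r: "of_nat q * of_nat (r i) = (of_nat (lucas_coeff (2 * i + 1) (m - i)) :: int poly)"
    if "i < m" for i
    using that by (metis of_nat_mult)
  have "of_nat q * R = (\<Sum>i<m. of_nat (lucas_coeff (2 * i + 1) (m - i)) * d ^ (2 * i) * g ^ (m - i))"
    unfolding R_def sum_distrib_left by (intro sum.cong refl) (simp only: lessThan_iff r[symmetric] mult.assoc)
  then show "lucas_quot d g m = d ^ (2 * m) + of_nat q * R"
    by (simp add: lucas_quot_def lessThan_Suc_atMost[symmetric])
  have "d \<noteq> 0" using deg by auto
  show "degree R < degree (d ^ (2 * m))"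
    unfolding R_def
  proof (rule degree_sum_less)
    show "0 < degree (d ^ (2 * m))"
      using deg \<open>m > 0\<close> \<open>d \<noteq> 0\<close> by (simp add: degree_power_eq)
    fix i assume "i \<in> {..<m}"
    then have "i < m" by simp
    have "degree (of_nat (r i) * d ^ (2 * i) * g ^ (m - i))
        \<le> degree (of_nat (r i) :: int poly) + degree (d ^ (2 * i)) + degree (g ^ (m - i))"
      by (meson add_mono degree_mult_le order.trans order_refl)
    also have "\<dots> \<le> degree d * (2 * i) + degree g * (m - i)"
      using degree_power_le[of d "2 * i"] degree_power_le[of g "m - i"] by (simp add: add_mono)
    \<comment> \<open>Strictness needs \<open>i < m\<close>: the term contains a positive power of
      \<open>g\<close>, whose degree is smaller than that of \<open>d\<close>.\<close>
    also have "\<dots> < degree d * (2 * i) + degree d * (m - i)"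
      using deg \<open>i < m\<close> by simp
    also have "\<dots> = degree d * (i + m)"
      using \<open>i < m\<close> by (simp flip: distrib_left)
    also have "\<dots> \<le> degree (d ^ (2 * m))"
      using \<open>i < m\<close> \<open>d \<noteq> 0\<close> by (simp add: degree_power_eq)
    finally show "degree (of_nat (r i) * d ^ (2 * i) * g ^ (m - i)) < degree (d ^ (2 * m))" .
  qed
  \<comment> \<open>The coefficient at \<open>i = 0\<close> is \<open>2 * m + 1 = q\<close>, so
    dividing by \<open>q\<close> leaves exactly \<open>g ^ m\<close>; all later terms of
    \<open>R\<close> contain a factor \<open>d\<close>.\<close>
  have "r 0 = 1"
    using q by (simp add: r_def lucas_coeff_1)
  obtain n where "m = Suc n" using \<open>m > 0\<close> by (cases m) auto
  have "R - g ^ m = (\<Sum>i<n. of_nat (r (Suc i)) * d ^ (2 * Suc i) * g ^ (m - Suc i))"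
    unfolding R_def \<open>m = Suc n\<close> by (subst sum.lessThan_Suc_shift) (simp add: \<open>r 0 = 1\<close>)
  then show "d dvd R - g ^ m"
    by (auto intro!: dvd_sum)
qed

section \<open>Irreducibility\<close>

theorem proposition4p6:
  fixes p0 :: int and p1 g d :: "int poly" and q k :: nat
  assumes "lucas_type p0 p1 g"
    and "d = lucas_d p0 p1"
    and "prime q" and "q > 2"
    and "degree d = k"
    and "[coeff d k \<noteq> 0] (mod int q)"
    and "\<forall>i<k. [coeff d i = 0] (mod int q)"
    and "[poly g 0 \<noteq> 0] (mod int q)"
  shows "p1 dvd lucas_poly p0 p1 g q \<and>
         irreducible (map_poly rat_of_int (lucas_poly p0 p1 g q div p1))"
proof -
  define m where "m = q div 2"
  have "odd q"
    using assms(3,4) by (simp add: prime_odd_nat)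
  then have q: "q = 2 * m + 1" and "m > 0"
    using assms(4) by (auto simp: m_def)
  have p0: "\<bar>p0\<bar> \<in> {1, 2}" and "p1 \<noteq> 0" and deg: "degree g < degree d"
    using assms(1,2) by (simp_all add: lucas_type_def)
  have "p0 = 1 \<or> p0 = - 1 \<or> p0 = 2 \<or> p0 = - 2"
    using p0 by auto
  then have "lucas_alpha p0 * p0 = 2"
    by (auto simp: lucas_alpha_def)
  then have L: "lucas_poly p0 p1 g q = p1 * lucas_quot d g m"
    using lucas_poly_even_odd assms(2) q by blast
  obtain R where R: "lucas_quot d g m = d ^ (2 * m) + of_nat q * R"
      "degree R < degree (d ^ (2 * m))" "d dvd R - g ^ m"
    using lucas_quot_mod_prime[OF assms(3) q \<open>m > 0\<close> deg] .
  have prime: "prime (int q)"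
    using assms(3) by simp
  have not_dvd_lead: "\<not> int q dvd lead_coeff d"
    using assms(5,6) by (simp add: cong_0_iff)
  have dvd_lower: "int q dvd coeff d i" if "i < degree d" for i
    using assms(5,7) that by (simp add: cong_0_iff)
  have coeff: "coeff (lucas_quot d g m) i = coeff (d ^ (2 * m)) i + int q * coeff R i" for i
    by (simp add: R(1) of_nat_poly)
  have "degree (of_nat q * R) < degree (d ^ (2 * m))"
    using R(2) degree_mult_le[of "of_nat q" R] by simp
  then have degree: "degree (lucas_quot d g m) = degree (d ^ (2 * m))"
    unfolding R(1) by (rule degree_add_eq_left)
  have "irreducible (map_poly rat_of_int (lucas_quot d g m))"
  proof (rule eisenstein[OF prime])
    show "0 < degree (lucas_quot d g m)"
      unfolding degree using R(2) by simp
    \<comment> \<open>\<open>R\<close> has smaller degree, so it contributes nothing at the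
      top.\<close>
    have "lead_coeff (lucas_quot d g m) = lead_coeff d ^ (2 * m)"
      using R(2) by (simp add: degree coeff coeff_eq_0 lead_coeff_power)
    then show "\<not> int q dvd lead_coeff (lucas_quot d g m)"
      using not_dvd_lead prime prime_dvd_power by metis
    show "int q dvd coeff (lucas_quot d g m) i" if "i < degree (lucas_quot d g m)" for i
      using dvd_lower_coeff_power[of d "int q" i "2 * m"] that dvd_lower deg
      unfolding coeff degree by fastforce
    show "\<not> (int q)\<^sup>2 dvd coeff (lucas_quot d g m) 0"
    proof
      assume dvd: "(int q)\<^sup>2 dvd coeff (lucas_quot d g m) 0"
      have "int q dvd coeff d 0"
        using dvd_lower deg by simp
      \<comment> \<open>As \<open>2 * m \<ge> 2\<close>, the power of \<open>d\<close> vanishes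
        modulo the square of \<open>q\<close> at 0. Hence only \<open>q * coeff R 0\<close> matters,
        and \<open>coeff R 0\<close> is congruent to \<open>coeff g 0 ^ m\<close> modulo
        \<open>q\<close>.\<close>
      have "(int q)\<^sup>2 dvd coeff d 0 ^ (2 * m)"
        using \<open>int q dvd coeff d 0\<close> \<open>m > 0\<close> by (intro dvd_power_le) auto
      then have "(int q)\<^sup>2 dvd coeff (d ^ (2 * m)) 0"
        by (simp add: coeff_0_power)
      with dvd have "(int q)\<^sup>2 dvd int q * coeff R 0"
        unfolding coeff by (simp add: dvd_add_right_iff)
      then have "int q dvd coeff R 0"
        using assms(4) by (simp add: power2_eq_square)
      moreover have "int q dvd coeff R 0 - coeff g 0 ^ m"
      proof -
        obtain S where "R - g ^ m = d * S" using R(3) ..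
        then have "coeff R 0 - coeff (g ^ m) 0 = coeff d 0 * coeff S 0"
          by (metis coeff_diff coeff_mult_0)
        then show ?thesis
          using \<open>int q dvd coeff d 0\<close> by (simp add: coeff_0_power)
      qed
      ultimately have "int q dvd coeff g 0 ^ m"
        by (metis dvd_diff_right_iff)
      then show False
        using assms(8) prime_dvd_power[OF prime]
        by (auto simp: cong_0_iff poly_0_coeff_0)
    qed
  qed
  then show ?thesis
    using L \<open>p1 \<noteq> 0\<close> by simp
qed

end
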